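(* Let $G$ be a connected graph with $n$ vertices and diameter $\delta$, and let $k\geq 1$ be an integer with $n\geq k+1$. Then the $k$-token graph $F_k(G)$ is connected, and its diameter is at least $k(\delta-k+1)$ and at most $k\delta$.
   Context: Graphs are finite, simple and undirected. For a graph $G$ and an integer $k\geq 1$, the $k$-token graph $F_k(G)$ is the graph whose vertices are the $k$-element subsets of $V(G)$, where two vertices $A,B$ are adjacent whenever their symmetric difference $A\triangle B$ is a pair $\{a,b\}$ with $a\in A$, $b\in B$ and $ab\in E(G)$. The lower bound $k(\delta-k+1)$ is an integer that may be negative. *)

theory Defs
  imports "Graph_Theory.Graph_Theory"
begin

text \<open>
  A finite simple undirected graph is a \<^locale>\<open>pair_graph\<close>: a finite loop-free digraph whose
  arc relation is symmetric, each edge being represented by its two orientations.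
\<close>

text \<open>
  With unit arc weights the cost of a walk is its length, so the library's \<open>\<mu>\<close> becomes the
  usual distance, which is infinite between vertices in different components.
\<close>

lemma (in wf_digraph) awalk_cost_unit: "awalk_cost (\<lambda>_. 1) p = real (length p)"
  by (induction p) simp_all

definition distance :: "('a, 'b) pre_digraph \<Rightarrow> 'a \<Rightarrow> 'a \<Rightarrow> ereal" where
  "distance G u v = wf_digraph.\<mu> G (\<lambda>_. 1) u v"

definition diameter :: "('a, 'b) pre_digraph \<Rightarrow> ereal" where
  "diameter G = (SUP u \<in> verts G. SUP v \<in> verts G. distance G u v)"

definition token_graph :: "nat \<Rightarrow> 'a pair_pre_digraph \<Rightarrow> 'a set pair_pre_digraph" where
  "token_graph k G = \<lparr>
     pverts = {A. A \<subseteq> pverts G \<and> card A = k},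
     parcs = {(A, B). A \<subseteq> pverts G \<and> card A = k \<and> B \<subseteq> pverts G \<and> card B = k \<and>
       (\<exists>a\<in>A. \<exists>b\<in>B. sym_diff A B = {a, b} \<and> (a, b) \<in> parcs G)}\<rparr>"

lemma pair_graph_token_graph:
  assumes "pair_graph G"
  shows "pair_graph (token_graph k G)"
proof -
  interpret G: pair_graph G by fact
  let ?F = "token_graph k G"
  have fin: "finite (pverts ?F)"
    using G.pair_finite_verts by (simp add: token_graph_def)
  have sub: "parcs ?F \<subseteq> pverts ?F \<times> pverts ?F"
    by (auto simp: token_graph_def)
  have fin_arcs: "finite (parcs ?F)"
    using fin sub by (meson finite_SigmaI finite_subset)
  have sym: "(B, A) \<in> parcs ?F" if "(A, B) \<in> parcs ?F" for A B
  proof -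
    from that obtain a b where ab: "a \<in> A" "b \<in> B" "sym_diff A B = {a, b}" "(a, b) \<in> parcs G"
      and AB: "A \<subseteq> pverts G" "card A = k" "B \<subseteq> pverts G" "card B = k"
      unfolding token_graph_def by auto
    have "(b, a) \<in> parcs G"
      using ab(4) by (rule G.arcs_symmetric)
    moreover have "sym_diff B A = {b, a}"
      using ab(3) by (simp add: Un_commute insert_commute)
    ultimately show ?thesis
      unfolding token_graph_def using ab(1,2) AB by simp blast
  qed
  have loop: "A \<noteq> B" if "(A, B) \<in> parcs ?F" for A B
    using that unfolding token_graph_def by (simp, blast)
  show ?thesis
  proof unfold_locales
    fix e assume e: "e \<in> parcs ?F"
    show "fst e \<in> pverts ?F" "snd e \<in> pverts ?F"
      using e sub by auto
    show "fst e \<noteq> snd e"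
      using e loop[of "fst e" "snd e"] by simp
  next
    show "symmetric (with_proj ?F)"
      using sym by (simp add: symmetric_def sym_def)
  qed (rule fin fin_arcs)+
qed

end

theory Submission
  imports Defs
begin

text \<open>
  Upper bound: along a walk of length \<open>l\<close> from \<open>a \<in> A\<close> to \<open>b \<notin> A\<close> one can exchange \<open>a\<close> for \<open>b\<close> in
  \<open>A\<close> by at most \<open>l\<close> token moves, where a token met on the way takes over the remaining part of the
  walk. Exchanging the elements of \<open>A - B\<close> for those of \<open>B - A\<close> one at a time costs at most \<open>k \<delta>\<close>.

  Lower bound: if \<open>x\<close> and \<open>y\<close> are at distance \<open>\<delta>\<close>, the sum of the distances from \<open>x\<close> over a token
  configuration changes by at most one per move. It differs by \<open>k (\<delta> - k + 1)\<close> between the first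
  \<open>k\<close> and the last \<open>k\<close> vertices of a shortest path from \<open>x\<close> to \<open>y\<close>.
\<close>

section \<open>Distance and diameter\<close>

context wf_digraph
begin

lemma distance_le_length:
  assumes "awalk u p v"
  shows "distance G u v \<le> ereal (real (length p))"
  using min_cost_le_walk_cost[OF assms, of "\<lambda>_. 1"] by (simp add: distance_def awalk_cost_unit)

text \<open>If \<open>v\<close> is unreachable, the premise is vacuous and the infimum over no walks
  is infinite.\<close>

lemma distance_geI:
  assumes "\<And>p. awalk u p v \<Longrightarrow> c \<le> ereal (real (length p))"
  shows "c \<le> distance G u v"
  unfolding distance_def \<mu>_def using assms by (intro INF_greatest) (simp add: awalk_cost_unit)

text \<open>Walk lengths are natural numbers, so the infimum is attained once some walk
  exists.\<close>

lemma shortest_awalk: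
  assumes "u \<rightarrow>\<^sup>* v"
  obtains p where "awalk u p v" "distance G u v = ereal (real (length p))"
proof -
  from assms obtain p0 where "awalk u p0 v"
    by (auto simp: reachable_awalk)
  then obtain p where p: "awalk u p v" "\<And>q. awalk u q v \<Longrightarrow> length p \<le> length q"
    using ex_has_least_nat[of "\<lambda>p. awalk u p v" p0 length] by blast
  have "distance G u v = ereal (real (length p))"
    by (rule antisym[OF distance_le_length[OF p(1)] distance_geI]) (simp add: p(2))
  with p(1) show thesis by (rule that)
qed

text \<open>Prefixes of shortest walks are shortest: a shorter walk to the vertex reached after
  \<open>i\<close> arcs, followed by the rest of \<open>p\<close>, would beat \<open>p\<close>. This
  puts a vertex in every distance layer.\<close>

lemma intermediate_distance:
  assumes "awalk u p v" and dist: "distance G u v = ereal (real (length p))" and i: "i \<le> length p"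
  obtains w where "w \<in> verts G" "distance G u w = ereal (real i)"
proof -
  have "awalk u (take i p @ drop i p) v"
    using assms(1) by simp
  then obtain w where w: "awalk u (take i p) w" "awalk w (drop i p) v"
    by (metis awalk_append_iff)
  then obtain q where q: "awalk u q w" "distance G u w = ereal (real (length q))"
    using shortest_awalk reachable_awalkI by metis
  have "length q \<le> i"
    using distance_le_length[OF w(1)] q(2) i by simp
  moreover have "awalk u (q @ drop i p) v"
    using q(1) w(2) by (rule awalk_appendI)
  then have "length p \<le> length q + (length p - i)"
    using distance_le_length[of u "q @ drop i p" v] dist by simp
  ultimately have "length q = i"
    using i by linarith
  then show thesis
    using q w that awalk_last_in_verts by blast
qed

end

lemma distance_le_diameter:
  assumes "u \<in> verts G" "v \<in> verts G"
  shows "distance G u v \<le> diameter G"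
  unfolding diameter_def using assms by (meson SUP_upper SUP_upper2)

lemma diameter_leI:
  assumes "\<And>u v. u \<in> verts G \<Longrightarrow> v \<in> verts G \<Longrightarrow> distance G u v \<le> c"
  shows "diameter G \<le> c"
  unfolding diameter_def using assms by (intro SUP_least)

text \<open>Over a finite nonempty set a supremum is a maximum; this is applied to both nested
  suprema.\<close>

lemma diameter_attained:
  assumes "finite (verts G)" "verts G \<noteq> {}"
  obtains u v where "u \<in> verts G" "v \<in> verts G" "diameter G = distance G u v"
proof -
  have att: "\<exists>w\<in>verts G. (SUP v\<in>verts G. f v) = f w" for f :: "'a \<Rightarrow> ereal"
  proof -
    have "Max (f ` verts G) \<in> f ` verts G"
      using assms by (intro Max_in) auto
    then show ?thesis
      using assms Max_Sup[of "f ` verts G"] by auto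
  qed
  show thesis
    using att[of "\<lambda>u. SUP v\<in>verts G. distance G u v"] att[of "distance G _"] that
    unfolding diameter_def by metis
qed

text \<open>\<open>connected\<close> refers to the symmetric closure, which has the same
  reachability when the arcs are already symmetric.\<close>

lemma (in sym_digraph) connected_iff_reachable:
  "connected G \<longleftrightarrow> verts G \<noteq> {} \<and> (\<forall>u\<in>verts G. \<forall>v\<in>verts G. u \<rightarrow>\<^sup>* v)"
  unfolding connected_def strongly_connected_def using reachable_mk_symmetric_eq sym_arcs by auto

section \<open>Token moves\<close>

lemma verts_token_graph:
  "pverts (token_graph k G) = {A. A \<subseteq> pverts G \<and> card A = k}"
  by (simp add: token_graph_def)

context pair_graph
begin

lemma token_arcI:
  assumes A: "A \<subseteq> pverts G" "card A = k" and "a \<in> A" "b \<notin> A" "(a, b) \<in> parcs G"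
  shows "(A, insert b (A - {a})) \<in> parcs (token_graph k G)"
proof -
  have "finite A"
    using A(1) pair_finite_verts finite_subset by blast
  then have "card (insert b (A - {a})) = k"
    using assms by (metis DiffD1 card.remove card_insert_disjoint finite_Diff)
  moreover have "sym_diff A (insert b (A - {a})) = {a, b}"
    using assms by auto
  moreover have "insert b (A - {a}) \<subseteq> pverts G"
    using assms in_arcsD2 by auto
  ultimately show ?thesis
    using assms unfolding token_graph_def by auto
qed

text \<open>A member of \<open>A\<close> in the symmetric difference lies outside \<open>B\<close>,
  and vice versa, so an arc is one token leaving \<open>a\<close> for the vacant vertex
  \<open>b\<close>.\<close>

lemma token_arcE:
  assumes "(A, B) \<in> parcs (token_graph k G)"
  obtains a b where "a \<in> A" "b \<notin> A" "B = insert b (A - {a})" "(a, b) \<in> parcs G"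
proof -
  from assms obtain a b where ab: "a \<in> A" "b \<in> B" "sym_diff A B = {a, b}" "(a, b) \<in> parcs G"
    by (auto simp: token_graph_def)
  have "a \<noteq> b"
    using ab(4) no_loops' by blast
  have "b \<notin> A" "B = insert b (A - {a})"
    using ab(1-3) \<open>a \<noteq> b\<close> by (blast | auto simp: set_eq_iff)+
  with ab that show thesis by blast
qed

section \<open>Upper bound on token distances\<close>

lemma token_awalk_exchange:
  assumes "awalk a p b" "A \<subseteq> pverts G" "card A = k" "a \<in> A" "b \<notin> A"
  shows "\<exists>q. pre_digraph.awalk (with_proj (token_graph k G)) A q (insert b (A - {a}))
    \<and> length q \<le> length p"
  using assms
proof (induction p arbitrary: a A)
  case Nil
  then show ?case by (simp add: awalk_Nil_iff)
next
  case (Cons e p)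
  interpret F: pair_graph "token_graph k G"
    using pair_graph_axioms by (rule pair_graph_token_graph)
  obtain c where e: "e = (a, c)" "(a, c) \<in> parcs G" "awalk c p b"
    using Cons.prems(1) by (cases e) (auto simp: awalk_Cons_iff)
  have arc: "F.awalk S [(S, insert d (S - {s}))] (insert d (S - {s}))"
    if "S \<subseteq> pverts G" "card S = k" "s \<in> S" "d \<notin> S" "(s, d) \<in> parcs G" for S s d
    using F.arc_implies_awalk[OF token_arcI[OF that]] by simp
  have move: "insert d (S - {s}) \<subseteq> pverts G \<and> card (insert d (S - {s})) = k"
    if "F.awalk S q (insert d (S - {s}))" for S q s d
    using F.awalk_last_in_verts[OF that] by (simp add: verts_token_graph)
  have "a \<noteq> c"
    using e(2) no_loops' by blast
  show ?case
  proof (cases "c \<in> A")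
    case True
    \<comment> \<open>The token on \<open>c\<close> travels to \<open>b\<close> first, which vacates
      \<open>c\<close> for the token on \<open>a\<close>. Tokens are indistinguishable, so the
      outcome is the required exchange.\<close>
    obtain q where q: "F.awalk A q (insert b (A - {c}))" "length q \<le> length p"
      using Cons.IH[OF e(3) Cons.prems(2,3) True Cons.prems(5)] by blast
    let ?A' = "insert b (A - {c})"
    have "c \<noteq> b"
      using True Cons.prems(5) by blast
    then have "F.awalk ?A' [(?A', insert c (?A' - {a}))] (insert c (?A' - {a}))"
      using move[OF q(1)] \<open>a \<noteq> c\<close> Cons.prems(4) e(2) by (intro arc) auto
    moreover have "insert c (?A' - {a}) = insert b (A - {a})"
      using True \<open>a \<noteq> c\<close> Cons.prems(4,5) by auto
    ultimately have "F.awalk A (q @ [(?A', insert b (A - {a}))]) (insert b (A - {a}))"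
      using F.awalk_appendI[OF q(1)] by metis
    then show ?thesis
      using q(2) by (intro exI[of _ "q @ [(?A', insert b (A - {a}))]"]) simp
  next
    case False
    let ?A' = "insert c (A - {a})"
    have step: "F.awalk A [(A, ?A')] ?A'"
      using Cons.prems False e(2) by (intro arc)
    show ?thesis
    \<comment> \<open>If \<open>c = b\<close>, one move suffices even when \<open>p\<close> is
      nonempty; the induction hypothesis would not apply, since it wants \<open>b\<close>
      vacant.\<close>
    proof (cases "c = b")
      case True
      then show ?thesis
        using step by (intro exI[of _ "[(A, ?A')]"]) simp
    next
      case neq: False
      then obtain q where q: "F.awalk ?A' q (insert b (?A' - {c}))" "length q \<le> length p"
        using Cons.IH[of c ?A'] e(3) move[OF step] Cons.prems(5) by auto
      moreover have "insert b (?A' - {c}) = insert b (A - {a})"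
        using False by auto
      ultimately have "F.awalk A ([(A, ?A')] @ q) (insert b (A - {a}))"
        using F.awalk_appendI[OF step q(1)] by metis
      then show ?thesis
        using q(2) by (intro exI[of _ "[(A, ?A')] @ q"]) simp
    qed
  qed
qed

text \<open>The bound uses \<open>card (A - B)\<close> rather than \<open>k\<close> because each
  exchange lowers it by one at cost at most \<open>d\<close>, so the induction adds up.\<close>

lemma token_awalk_bounded:
  assumes walks: "\<And>u v. u \<in> pverts G \<Longrightarrow> v \<in> pverts G \<Longrightarrow> \<exists>p. awalk u p v \<and> length p \<le> d"
    and "A \<subseteq> pverts G" "card A = k" "B \<subseteq> pverts G" "card B = k"
  shows "\<exists>q. pre_digraph.awalk (with_proj (token_graph k G)) A q B \<and> length q \<le> card (A - B) * d"
  using assms(2-5)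
proof (induction "card (A - B)" arbitrary: A)
  case 0
  interpret F: pair_graph "token_graph k G"
    using pair_graph_axioms by (rule pair_graph_token_graph)
  have "finite A" "finite B"
    using 0 pair_finite_verts finite_subset by blast+
  then have "A = B"
    using 0 by (metis Diff_eq_empty_iff card_0_eq card_subset_eq finite_Diff)
  then have "F.awalk A [] B"
    using 0 by (simp add: F.awalk_Nil_iff verts_token_graph)
  then show ?case by (intro exI[of _ "[]"]) simp
next
  case (Suc m)
  interpret F: pair_graph "token_graph k G"
    using pair_graph_axioms by (rule pair_graph_token_graph)
  have fin: "finite A" "finite B"
    using Suc.prems pair_finite_verts finite_subset by blast+
  obtain a where a: "a \<in> A" "a \<notin> B"
    using Suc.hyps(2) by (metis DiffE card.empty ex_in_conv nat.simps(3))
  \<comment> \<open>\<open>B\<close> is as large as \<open>A\<close>; if contained in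
    \<open>A\<close> it would equal \<open>A\<close> and contain \<open>a\<close>.\<close>
  obtain b where b: "b \<in> B" "b \<notin> A"
    using a Suc.prems fin by (metis card_subset_eq subsetI)
  let ?A' = "insert b (A - {a})"
  obtain p where p: "awalk a p b" "length p \<le> d"
    using walks a b Suc.prems by blast
  then obtain q where q: "F.awalk A q ?A'" "length q \<le> d"
    using token_awalk_exchange[OF p(1) Suc.prems(1,2) a(1) b(2)] by auto
  have "?A' - B = (A - B) - {a}"
    using b by auto
  then have m: "m = card (?A' - B)"
    using Suc.hyps(2) a fin by simp
  then obtain r where r: "F.awalk ?A' r B" "length r \<le> m * d"
    using Suc.hyps(1)[of ?A'] F.awalk_last_in_verts[OF q(1)] Suc.prems(3,4)
    by (auto simp: verts_token_graph)
  have "F.awalk A (q @ r) B"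
    using F.awalk_appendI[OF q(1) r(1)] by simp
  moreover have "length (q @ r) \<le> card (A - B) * d"
    using q(2) r(2) Suc.hyps(2)[symmetric] by simp
  ultimately show ?case by blast
qed

section \<open>Lower bound on token distances\<close>

lemma token_awalk_potential:
  fixes f :: "'a \<Rightarrow> nat"
  assumes lip: "\<And>a b. (a, b) \<in> parcs G \<Longrightarrow> f b \<le> f a + 1"
    and "pre_digraph.awalk (with_proj (token_graph k G)) A p B"
  shows "sum f B \<le> sum f A + length p"
  using assms(2)
proof (induction p arbitrary: A)
  interpret F: pair_graph "token_graph k G"
    using pair_graph_axioms by (rule pair_graph_token_graph)
  {
    case Nil
    then show ?case by (simp add: F.awalk_Nil_iff)
  next
    case (Cons e p)
    obtain C where e: "e = (A, C)" "(A, C) \<in> parcs (token_graph k G)" "F.awalk C p B"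
      using Cons.prems by (cases e) (auto simp: F.awalk_Cons_iff)
    obtain a b where ab: "a \<in> A" "b \<notin> A" "C = insert b (A - {a})" "(a, b) \<in> parcs G"
      using e(2) by (rule token_arcE)
    have "A \<subseteq> pverts G"
      using F.in_arcsD1[OF e(2)] by (simp add: verts_token_graph)
    then have "finite A"
      using pair_finite_verts finite_subset by blast
    \<comment> \<open>Only the contribution of the moved token changes, from \<open>f a\<close> to
      \<open>f b\<close>.\<close>
    then have "sum f A = f a + sum f (A - {a})" "sum f C = f b + sum f (A - {a})"
      using ab by (simp_all add: sum.remove)
    then show ?case
      using lip[OF ab(4)] Cons.IH[OF e(3)] by simp
  }
qed

text \<open>The witnesses occupy the distances \<open>0\<close> to \<open>k - 1\<close> and
  \<open>d + 1 - k\<close> to \<open>d\<close> from \<open>x\<close>, so each of the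
  \<open>k\<close> tokens must gain \<open>d + 1 - k\<close>. By \<open>k \<le> d + 1\<close> this
  subtraction is not truncated.\<close>

lemma token_distance_ge:
  assumes reach: "\<And>v. v \<in> pverts G \<Longrightarrow> x \<rightarrow>\<^sup>*\<^bsub>with_proj G\<^esub> v"
    and y: "y \<in> pverts G" "distance (with_proj G) x y = ereal (real d)" and k: "k \<le> d + 1"
  obtains A B where "A \<in> pverts (token_graph k G)" "B \<in> pverts (token_graph k G)"
    "ereal (real (k * (d + 1 - k))) \<le> distance (with_proj (token_graph k G)) A B"
proof -
  interpret F: pair_graph "token_graph k G"
    using pair_graph_axioms by (rule pair_graph_token_graph)
  have "\<exists>p. awalk x p v \<and> distance (with_proj G) x v = ereal (real (length p))"
    if "v \<in> pverts G" for v
    using shortest_awalk[OF reach[OF that]] by blast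
  then obtain P where P: "\<And>v. v \<in> pverts G \<Longrightarrow> awalk x (P v) v"
      "\<And>v. v \<in> pverts G \<Longrightarrow> distance (with_proj G) x v = ereal (real (length (P v)))"
    by metis
  \<comment> \<open>\<open>f\<close> is the distance from \<open>x\<close> as a natural
    number.\<close>
  define f where "f v = length (P v)" for v
  have lip: "f b \<le> f a + 1" if "(a, b) \<in> parcs G" for a b
  proof -
    have ab: "a \<in> pverts G" "b \<in> pverts G"
      using that wellformed' by blast+
    have "awalk x (P a @ [(a, b)]) b"
      using P(1)[OF ab(1)] arc_implies_awalk[OF that] by (auto intro: awalk_appendI)
    then have "ereal (real (f b)) \<le> ereal (real (length (P a @ [(a, b)])))"
      using distance_le_length P(2)[OF ab(2)] unfolding f_def by metis
    then show ?thesis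
      by (simp add: f_def)
  qed
  have "\<exists>w. w \<in> pverts G \<and> f w = i" if i: "i \<le> d" for i
  proof -
    have "length (P y) = d"
      using P(2)[OF y(1)] y(2) by simp
    then obtain w where "w \<in> pverts G" "distance (with_proj G) x w = ereal (real i)"
      using intermediate_distance[OF P(1,2)[OF y(1)]] i by metis
    then show ?thesis
      using P(2)[of w] by (auto simp: f_def)
  qed
  \<comment> \<open>One vertex is chosen per distance; they need not lie on a common path, as only
    their \<open>f\<close> values matter.\<close>
  then obtain v where v: "\<And>i. i \<le> d \<Longrightarrow> v i \<in> pverts G" "\<And>i. i \<le> d \<Longrightarrow> f (v i) = i"
    by metis
  have conf: "v ` (\<lambda>i. i + j) ` {..<k} \<in> pverts (token_graph k G)"
      "sum f (v ` (\<lambda>i. i + j) ` {..<k}) = (\<Sum>i<k. i) + k * j" if "j \<le> d + 1 - k" for j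
  proof -
    have bd: "i + j \<le> d" if "i < k" for i
      using that \<open>j \<le> d + 1 - k\<close> k by linarith
    have inj: "inj_on (\<lambda>i. v (i + j)) {..<k}"
      \<comment> \<open>\<open>f\<close> recovers the index, so the \<open>k\<close> tokens sit on
        distinct vertices.\<close>
      by (rule inj_on_inverseI[of _ "\<lambda>w. f w - j"]) (simp add: v(2) bd)
    show "v ` (\<lambda>i. i + j) ` {..<k} \<in> pverts (token_graph k G)"
      using v(1) bd card_image[OF inj] by (auto simp: verts_token_graph image_image)
    show "sum f (v ` (\<lambda>i. i + j) ` {..<k}) = (\<Sum>i<k. i) + k * j"
      using sum.reindex[OF inj, of f] by (simp add: image_image v(2) bd sum.distrib)
  qed
  let ?A = "v ` (\<lambda>i. i + 0) ` {..<k}" and ?B = "v ` (\<lambda>i. i + (d + 1 - k)) ` {..<k}"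
  have "ereal (real (k * (d + 1 - k))) \<le> distance (with_proj (token_graph k G)) ?A ?B"
  proof (rule F.distance_geI)
    fix p assume "F.awalk ?A p ?B"
    then have "sum f ?B \<le> sum f ?A + length p"
      using lip by (rule token_awalk_potential[rotated])
    then have "k * (d + 1 - k) \<le> length p"
      unfolding conf(2)[OF order_refl] conf(2)[OF le0] by simp
    then show "ereal (real (k * (d + 1 - k))) \<le> ereal (real (length p))"
      by (simp only: ereal_less_eq of_nat_le_iff)
  qed
  then show thesis
    using that conf(1)[OF le0] conf(1)[OF order_refl] by blast
qed

end

section \<open>Connectedness and diameter of the token graph\<close>

theorem theorem1:
  fixes G :: "'a pair_pre_digraph" and n k \<delta> :: nat
  assumes "pair_graph G"
    and "connected (with_proj G)"
    and "card (pverts G) = n"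
    and "diameter (with_proj G) = ereal (real \<delta>)"
    and "k \<ge> 1"
    and "n \<ge> k + 1"
  shows "connected (with_proj (token_graph k G))
    \<and> ereal (real_of_int (int k * (int \<delta> - int k + 1))) \<le> diameter (with_proj (token_graph k G))
    \<and> diameter (with_proj (token_graph k G)) \<le> ereal (real (k * \<delta>))"
proof -
  interpret G: pair_graph G by fact
  interpret F: pair_graph "token_graph k G"
    using assms(1) by (rule pair_graph_token_graph)
  have ne: "pverts G \<noteq> {}"
    using assms(2) G.connected_iff_reachable by simp
  have reach: "u \<rightarrow>\<^sup>*\<^bsub>with_proj G\<^esub> v" if "u \<in> pverts G" "v \<in> pverts G" for u v
    using assms(2) that G.connected_iff_reachable by auto
  have walks: "\<exists>p. G.awalk u p v \<and> length p \<le> \<delta>" if uv: "u \<in> pverts G" "v \<in> pverts G" for u v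
  proof -
    obtain p where p: "G.awalk u p v" "distance (with_proj G) u v = ereal (real (length p))"
      using G.shortest_awalk reach[OF uv] by blast
    have "ereal (real (length p)) \<le> ereal (real \<delta>)"
      using distance_le_diameter[of u "with_proj G" v] uv p(2) assms(4) by simp
    then show ?thesis
      using p(1) by auto
  qed
  have token_walks: "\<exists>q. F.awalk A q B \<and> length q \<le> k * \<delta>"
    if AB: "A \<in> pverts (token_graph k G)" "B \<in> pverts (token_graph k G)" for A B
  proof -
    have A: "A \<subseteq> pverts G" "card A = k" and B: "B \<subseteq> pverts G" "card B = k"
      using AB by (auto simp: verts_token_graph)
    obtain q where q: "F.awalk A q B" "length q \<le> card (A - B) * \<delta>"
      using G.token_awalk_bounded[OF walks A B] by blast
    have "card (A - B) \<le> k"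
      using A G.pair_finite_verts by (metis Diff_subset card_mono finite_subset)
    then show ?thesis
      using q by (meson le_trans mult_le_mono1)
  qed
  \<comment> \<open>Connectedness requires a vertex; \<open>A0\<close> also shows below that the
    diameter is nonnegative.\<close>
  obtain A0 where A0: "A0 \<in> pverts (token_graph k G)"
    using obtain_subset_with_card_n[of k "pverts G"] assms(3,6) by (auto simp: verts_token_graph)
  have "connected (with_proj (token_graph k G))"
    using A0 token_walks by (auto simp: F.connected_iff_reachable F.reachable_awalk)
  moreover have "diameter (with_proj (token_graph k G)) \<le> ereal (real (k * \<delta>))"
  proof (rule diameter_leI)
    fix A B
    assume "A \<in> verts (with_proj (token_graph k G))" "B \<in> verts (with_proj (token_graph k G))"
    then obtain q where q: "F.awalk A q B" "length q \<le> k * \<delta>"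
      using token_walks by auto
    show "distance (with_proj (token_graph k G)) A B \<le> ereal (real (k * \<delta>))"
      using F.distance_le_length[OF q(1)] q(2)
      by (meson ereal_less_eq(3) of_nat_le_iff order_trans)
  qed
  moreover have "ereal (real_of_int (int k * (int \<delta> - int k + 1)))
      \<le> diameter (with_proj (token_graph k G))"
  \<comment> \<open>For \<open>k > \<delta> + 1\<close> there are too few distance layers for
    \<open>k\<close> tokens, but then the lower bound is at most \<open>0\<close>.\<close>
  proof (cases "k \<le> \<delta> + 1")
    case True
    obtain x y where xy: "x \<in> pverts G" "y \<in> pverts G"
        "distance (with_proj G) x y = ereal (real \<delta>)"
      using diameter_attained[of "with_proj G"] G.pair_finite_verts ne assms(4)
      by (metis with_proj_simps(1))
    obtain A B where AB: "A \<in> pverts (token_graph k G)" "B \<in> pverts (token_graph k G)"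
        "ereal (real (k * (\<delta> + 1 - k))) \<le> distance (with_proj (token_graph k G)) A B"
      using G.token_distance_ge[OF reach[OF xy(1)] xy(2,3) True] by blast
    have "int \<delta> - int k + 1 = int (\<delta> + 1 - k)"
      using True by linarith
    then have "real_of_int (int k * (int \<delta> - int k + 1)) = real (k * (\<delta> + 1 - k))"
      by simp
    then show ?thesis
      using AB distance_le_diameter[of A "with_proj (token_graph k G)" B]
      by (metis order_trans with_proj_simps(1))
  next
    case False
    have "int k * (int \<delta> - int k + 1) \<le> 0"
      using False by (intro mult_nonneg_nonpos) auto
    then have "ereal (real_of_int (int k * (int \<delta> - int k + 1))) \<le> 0"
      by (simp only: ereal_less_eq of_int_le_0_iff)
    also have "0 \<le> distance (with_proj (token_graph k G)) A0 A0"
      by (rule F.distance_geI) simp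
    also have "\<dots> \<le> diameter (with_proj (token_graph k G))"
      using A0 by (intro distance_le_diameter) auto
    finally show ?thesis .
  qed
  ultimately show ?thesis by blast
qed

end
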